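(* An equivalence relation $E^{\mathrm{ce}}$ on $\omega$ extending $=^{\mathrm{ce}}$ is universal if and only if $E^{\mathrm{ce}}$ has the locking property.
   Context: Fix a standard (acceptable) enumeration $(\varphi_e)_{e\in\omega}$ of the partial computable functions and let $W_e=\operatorname{dom}(\varphi_e)$. Write $e=^{\mathrm{ce}}e'$ iff $W_e=W_{e'}$. Equivalence relations on $\omega$ extending $=^{\mathrm{ce}}$ are arbitrary (no definability or effectivity is assumed). An enumeration of a set $A$ is a surjection $\mu:\omega\to A$; $\mu[s]$ denotes the finite string $\mu(0),\dots,\mu(s-1)$. A learner is an arbitrary function $\mathbf{M}:\omega^{<\omega}\to\omega$ (no effectivity is assumed). A family $\mathfrak{K}$ of nonempty c.e. sets is $E^{\mathrm{ce}}$-learnable if there is a learner $\mathbf{M}$ such that for every $e$ with $W_e\in\mathfrak{K}$ and every enumeration $\mu$ of $W_e$ there is $i\in\omega$ with $i\mathrel{E^{\mathrm{ce}}}e$ and $\mathbf{M}(\mu[s])=i$ for all sufficiently large $s$. $E^{\mathrm{ce}}$ is universal if every family of nonempty c.e. sets is $E^{\mathrm{ce}}$-learnable (equivalently, $\{W_e:e\in\omega,\ W_e\neq\emptyset\}$ is $E^{\mathrm{ce}}$-learnable). $E^{\mathrm{ce}}$ has the locking property if for every nonempty c.e. set $W_e$ and every (not necessarily computable) sequence $(b_i)_{i\in\omega}$ of indices such that $W_{b_i}$ is finite for every $i$, $W_{b_i}\subseteq W_{b_{i+1}}$ for every $i$, and $\bigcup_{i\in\omega}W_{b_i}=W_e$,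 there exists $k\in\omega$ such that $b_i\mathrel{E^{\mathrm{ce}}}e$ for all $i\geq k$. *)

theory Defs
  imports Complex_Main
begin

datatype recf =
    Zero
  | Succ
  | Proj nat
  | Comp recf "recf list"
  | Prec recf recf
  | Mu recf

text \<open>
  Graph semantics of partial recursive programs: \<open>computes p xs y\<close> means that \<open>p\<close> halts on the
  argument tuple \<open>xs\<close> with output \<open>y\<close>. Arities are not part of the syntax: \<open>Zero\<close> and \<open>Proj i\<close> stand for
  the constant and the projections of every arity, and a subprogram applied to a tuple that it
  cannot handle diverges, so no functions beyond the partial recursive ones arise. The recursion
  variable and the searched variable come first in the tuple, and the accumulator second.
\<close>

inductive computes :: "recf \<Rightarrow> nat list \<Rightarrow> nat \<Rightarrow> bool" where
  Zero: "computes Zero xs 0"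
| Succ: "computes Succ [x] (Suc x)"
| Proj: "i < length xs \<Longrightarrow> computes (Proj i) xs (xs ! i)"
| Comp: "list_all2 (\<lambda>g y. computes g xs y) gs ys \<Longrightarrow> computes f ys z
          \<Longrightarrow> computes (Comp f gs) xs z"
| Prec_0: "computes f xs y \<Longrightarrow> computes (Prec f g) (0 # xs) y"
| Prec_Suc: "computes (Prec f g) (n # xs) y \<Longrightarrow> computes g (n # y # xs) z
          \<Longrightarrow> computes (Prec f g) (Suc n # xs) z"
| Mu: "computes f (n # xs) 0 \<Longrightarrow> (\<forall>m<n. \<exists>y. computes f (m # xs) (Suc y))
          \<Longrightarrow> computes (Mu f) xs n"

lemma computes_functional:
  assumes "computes p xs y" and "computes p xs z"
  shows "y = z"
  using assms
proof (induction arbitrary: z rule: computes.induct)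
  case (Comp xs gs ys f w)
  from Comp.prems obtain ys' where ys': "list_all2 (\<lambda>g y. computes g xs y) gs ys'"
    "computes f ys' z" by (auto elim: computes.cases)
  have "ys = ys'"
    using Comp.IH(1) ys'(1) by (auto simp: list_all2_conv_all_nth intro!: nth_equalityI)
  then show ?case using Comp.IH(2) ys'(2) by blast
next
  case (Prec_0 f xs y g)
  from Prec_0.prems have "computes f xs z" by (auto elim: computes.cases)
  then show ?case using Prec_0.IH by blast
next
  case (Prec_Suc f g n xs y w)
  from Prec_Suc.prems obtain y' where "computes (Prec f g) (n # xs) y'"
    "computes g (n # y' # xs) z" by (auto elim: computes.cases)
  then show ?case using Prec_Suc.IH by blast
next
  case (Mu f n xs)
  from Mu.prems have z: "computes f (z # xs) 0" "\<forall>m<z. \<exists>y. computes f (m # xs) (Suc y)"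
    by (auto elim: computes.cases)
  have "\<not> z < n" using Mu.IH z(1) by fastforce
  moreover have "\<not> n < z" using Mu.IH(1) z(2) by fastforce
  ultimately show ?case by simp
qed (auto elim: computes.cases)

definition partial_computable :: "(nat \<rightharpoonup> nat) \<Rightarrow> bool" where
  "partial_computable \<psi> \<longleftrightarrow> (\<exists>p. \<forall>x y. \<psi> x = Some y \<longleftrightarrow> computes p [x] y)"

definition partial_computable2 :: "(nat \<Rightarrow> nat \<rightharpoonup> nat) \<Rightarrow> bool" where
  "partial_computable2 \<psi> \<longleftrightarrow> (\<exists>p. \<forall>e x y. \<psi> e x = Some y \<longleftrightarrow> computes p [e, x] y)"

definition total_computable :: "(nat \<Rightarrow> nat) \<Rightarrow> bool" where
  "total_computable s \<longleftrightarrow> partial_computable (\<lambda>x. Some (s x))"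

text \<open>
  Acceptable numberings in the sense of Rogers: an enumeration of exactly the unary partial
  computable functions that has a universal function and satisfies the s-m-n property.
\<close>

definition acceptable_numbering :: "(nat \<Rightarrow> nat \<rightharpoonup> nat) \<Rightarrow> bool" where
  "acceptable_numbering \<phi> \<longleftrightarrow>
     range \<phi> = {\<psi>. partial_computable \<psi>} \<and>
     partial_computable2 \<phi> \<and>
     (\<forall>\<psi>. partial_computable2 \<psi> \<longrightarrow> (\<exists>s. total_computable s \<and> (\<forall>e. \<phi> (s e) = \<psi> e)))"

definition W :: "(nat \<Rightarrow> nat \<rightharpoonup> nat) \<Rightarrow> nat \<Rightarrow> nat set" where
  "W \<phi> e = dom (\<phi> e)"

definition ce :: "(nat \<Rightarrow> nat \<rightharpoonup> nat) \<Rightarrow> nat set \<Rightarrow> bool" where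
  "ce \<phi> A \<longleftrightarrow> (\<exists>e. A = W \<phi> e)"

definition ce_eq :: "(nat \<Rightarrow> nat \<rightharpoonup> nat) \<Rightarrow> nat rel" where
  "ce_eq \<phi> = {(e, e'). W \<phi> e = W \<phi> e'}"

definition enumeration :: "(nat \<Rightarrow> nat) \<Rightarrow> nat set \<Rightarrow> bool" where
  "enumeration \<mu> A \<longleftrightarrow> range \<mu> = A"

definition initial_string :: "(nat \<Rightarrow> nat) \<Rightarrow> nat \<Rightarrow> nat list" where
  "initial_string \<mu> s = map \<mu> [0..<s]"

definition learnable :: "(nat \<Rightarrow> nat \<rightharpoonup> nat) \<Rightarrow> nat rel \<Rightarrow> nat set set \<Rightarrow> bool" where
  "learnable \<phi> E K \<longleftrightarrow>
     (\<exists>M :: nat list \<Rightarrow> nat. \<forall>e. W \<phi> e \<in> K \<longrightarrow>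
        (\<forall>\<mu>. enumeration \<mu> (W \<phi> e) \<longrightarrow>
           (\<exists>i. (i, e) \<in> E \<and> (\<forall>\<^sub>F s in sequentially. M (initial_string \<mu> s) = i))))"

definition universal :: "(nat \<Rightarrow> nat \<rightharpoonup> nat) \<Rightarrow> nat rel \<Rightarrow> bool" where
  "universal \<phi> E \<longleftrightarrow> (\<forall>K. (\<forall>A\<in>K. ce \<phi> A \<and> A \<noteq> {}) \<longrightarrow> learnable \<phi> E K)"

definition locking_property :: "(nat \<Rightarrow> nat \<rightharpoonup> nat) \<Rightarrow> nat rel \<Rightarrow> bool" where
  "locking_property \<phi> E \<longleftrightarrow>
     (\<forall>e (b :: nat \<Rightarrow> nat).
        W \<phi> e \<noteq> {} \<and> (\<forall>i. finite (W \<phi> (b i))) \<and>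
        (\<forall>i. W \<phi> (b i) \<subseteq> W \<phi> (b (Suc i))) \<and> (\<Union>i. W \<phi> (b i)) = W \<phi> e \<longrightarrow>
        (\<exists>k. \<forall>i\<ge>k. (b i, e) \<in> E))"

end

theory Submission
  imports Defs "HOL-Library.Countable_Set"
begin

text \<open>
  If a learner succeeds on all nonempty c.e. sets, then each \<open>W\<^sub>e\<close> has a locking string \<open>\<sigma>\<close>: no
  continuation inside \<open>W\<^sub>e\<close> changes the conjecture. Any \<open>W\<^bsub>b\<^esub>\<close> with \<open>set \<sigma> \<subseteq> W\<^bsub>b\<^esub> \<subseteq> W\<^sub>e\<close> has an
  enumeration beginning with \<open>\<sigma>\<close>, so the conjecture on \<open>\<sigma>\<close> is correct for both \<open>b\<close> and \<open>e\<close>. Conversely, the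
  locking property yields a finite \<open>F \<subseteq> W\<^sub>e\<close> such that all finite sets between \<open>F\<close> and \<open>W\<^sub>e\<close> have
  indices equivalent to \<open>e\<close>; hence the learner that outputs a fixed representative of the class of an
  index for the finite set seen so far converges.
\<close>

section \<open>Programs for finite sets\<close>

lemma computes_one: "computes (Comp Succ [Zero]) xs 1"
  by (rule computes.Comp[where ys = "[0]"]) (use computes.Succ[of 0] in \<open>simp_all add: computes.Zero\<close>)

text \<open>Shifting \<open>S\<close> down by one lowers the bound, so induction on \<open>n\<close>
  applies. Primitive recursion serves here only as a case distinction: the value at 0 is hardwired,
  and at \<open>Suc x\<close> the decider of the shifted set is run on \<open>x\<close>.\<close>

lemma decide_bounded_set:
  assumes "S \<subseteq> {..<n}"
  shows "\<exists>p. \<forall>x. computes p [x] (if x \<in> S then 0 else 1)"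
  using assms
proof (induction n arbitrary: S)
  case 0
  then show ?case using computes_one by auto
next
  case (Suc n)
  have "{x. Suc x \<in> S} \<subseteq> {..<n}" using Suc.prems by auto
  from Suc.IH[OF this] obtain p where p: "\<And>x. computes p [x] (if Suc x \<in> S then 0 else 1)"
    by auto
  obtain q where q: "computes q [] (if 0 \<in> S then 0 else 1)"
  proof (cases "0 \<in> S")
    case True
    then show thesis using that[of Zero] computes.Zero by simp
  next
    case False
    then show thesis using that computes_one by auto
  qed
  \<comment> \<open>The tuple is predecessor, then accumulator; \<open>Proj 0\<close> discards the
    accumulator \<open>y\<close>.\<close>
  have step: "computes (Comp p [Proj 0]) [x, y] (if Suc x \<in> S then 0 else 1)" for x y
    by (rule computes.Comp[where ys = "[x]"]) (use p computes.Proj[of 0 "[x, y]"] in simp_all)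
  have "computes (Prec q (Comp p [Proj 0])) [x] (if x \<in> S then 0 else 1)" for x
  proof (induction x)
    case 0
    show ?case using q by (rule computes.Prec_0)
  next
    case (Suc x)
    show ?case by (rule computes.Prec_Suc[OF Suc.IH step])
  qed
  then show ?case by blast
qed

text \<open>A decider with 0 as its positive answer becomes a semidecider by unbounded search over a
  dummy variable \<open>m\<close>: the search stops at once if \<open>x \<in> S\<close> and never
  otherwise.\<close>

lemma finite_imp_domain:
  assumes "finite S"
  shows "\<exists>\<psi>. partial_computable \<psi> \<and> dom \<psi> = S"
proof -
  obtain n where "S \<subseteq> {..<n}"
    using assms finite_nat_iff_bounded by blast
  then obtain p where p: "\<And>x. computes p [x] (if x \<in> S then 0 else 1)"
    using decide_bounded_set by blast
  have f: "computes (Comp p [Proj 1]) [m, x] (if x \<in> S then 0 else 1)" for m x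
    by (rule computes.Comp[where ys = "[x]"]) (use p computes.Proj[of 1 "[m, x]"] in simp_all)
  have "computes (Mu (Comp p [Proj 1])) [x] y \<longleftrightarrow> x \<in> S \<and> y = 0" for x y
  proof
    assume *: "computes (Mu (Comp p [Proj 1])) [x] y"
    then have "computes (Comp p [Proj 1]) [y, x] 0"
      by (auto elim: computes.cases)
    then have x: "x \<in> S"
      using computes_functional[OF _ f] by (metis zero_neq_one)
    then have "computes (Mu (Comp p [Proj 1])) [x] 0"
      using f[of 0 x] by (auto intro: computes.Mu)
    then show "x \<in> S \<and> y = 0"
      using x * computes_functional by blast
  next
    assume "x \<in> S \<and> y = 0"
    then show "computes (Mu (Comp p [Proj 1])) [x] y"
      using f[of 0 x] by (auto intro: computes.Mu)
  qed
  then have "partial_computable (\<lambda>x. if x \<in> S then Some 0 else None)"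
    unfolding partial_computable_def by (intro exI[of _ "Mu (Comp p [Proj 1])"]) auto
  moreover have "dom (\<lambda>x. if x \<in> S then Some (0::nat) else None) = S"
    by (auto split: if_splits)
  ultimately show ?thesis by blast
qed

lemma finite_imp_ce:
  assumes "acceptable_numbering \<phi>" and "finite S"
  shows "ce \<phi> S"
proof -
  obtain \<psi> where "partial_computable \<psi>" "dom \<psi> = S"
    using finite_imp_domain[OF assms(2)] by blast
  moreover from this obtain e where "\<psi> = \<phi> e"
    using assms(1) unfolding acceptable_numbering_def by (metis CollectI imageE)
  ultimately show ?thesis unfolding ce_def W_def by blast
qed

section \<open>Locking strings of a learner\<close>

lemma initial_string_append:
  assumes "\<And>k. k < length \<sigma> \<Longrightarrow> \<mu> k = \<sigma> ! k"
  shows "initial_string \<mu> (length \<sigma> + n) = \<sigma> @ map \<mu> [length \<sigma>..<length \<sigma> + n]"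
proof -
  have "initial_string \<mu> (length \<sigma> + n) = map \<mu> [0..<length \<sigma>] @ map \<mu> [length \<sigma>..<length \<sigma> + n]"
    using upt_add_eq_append[of 0 "length \<sigma>" n] by (simp add: initial_string_def)
  moreover have "map \<mu> [0..<length \<sigma>] = \<sigma>"
    using assms by (intro nth_equalityI) auto
  ultimately show ?thesis by simp
qed

text \<open>Otherwise every string over \<open>A\<close> has an extension over \<open>A\<close> that
  changes the conjecture. Chaining such extensions yields an enumeration of \<open>A\<close> on
  which \<open>M\<close> never settles.\<close>

lemma locking_string_exists:
  assumes A: "A \<noteq> {}"
    and conv: "\<And>\<mu>. enumeration \<mu> A \<Longrightarrow> \<exists>i. \<forall>\<^sub>F s in sequentially. M (initial_string \<mu> s) = i"
  shows "\<exists>\<sigma>. set \<sigma> \<subseteq> A \<and> (\<forall>\<tau>. set \<tau> \<subseteq> A \<longrightarrow> M (\<sigma> @ \<tau>) = M \<sigma>)"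
proof (rule ccontr)
  assume "\<not> ?thesis"
  then have "\<forall>\<sigma>. set \<sigma> \<subseteq> A \<longrightarrow> (\<exists>\<tau>. set \<tau> \<subseteq> A \<and> M (\<sigma> @ \<tau>) \<noteq> M \<sigma>)" by simp
  then obtain t where t: "\<And>\<sigma>. set \<sigma> \<subseteq> A \<Longrightarrow> set (t \<sigma>) \<subseteq> A \<and> M (\<sigma> @ t \<sigma>) \<noteq> M \<sigma>" by metis
  obtain w :: "nat \<Rightarrow> nat" where w: "range w = A"
    using range_from_nat_into[OF A] by auto
  \<comment> \<open>Each stage forces a change of conjecture by \<open>t\<close> and then appends
    \<open>w n\<close>, so that every element of \<open>A\<close> occurs and the string grows by at
    least one.\<close>
  define c where "c = rec_nat [] (\<lambda>n \<sigma>. \<sigma> @ t \<sigma> @ [w n])"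
  have c_0: "c 0 = []" and c_Suc: "\<And>n. c (Suc n) = c n @ t (c n) @ [w n]"
    by (auto simp: c_def)
  have c_sub: "set (c n) \<subseteq> A" for n
    using t w by (induction n) (auto simp: c_0 c_Suc)
  have c_len: "n \<le> length (c n)" for n
    by (induction n) (auto simp: c_0 c_Suc)
  have c_prefix: "\<exists>zs. c n = c m @ zs" if "m \<le> n" for m n
    using that by (induction n rule: dec_induct) (auto simp: c_Suc)
  \<comment> \<open>Position \<open>k\<close> exists in \<open>c (Suc k)\<close> because
    \<open>c n\<close> has length at least \<open>n\<close>; the strings extend one another, so any
    stage long enough gives the same value.\<close>
  define \<mu> where "\<mu> k = c (Suc k) ! k" for k
  have \<mu>: "\<mu> k = c n ! k" if "k < length (c n)" for k n
  proof -
    have "k < length (c (Suc k))" using c_len[of "Suc k"] by simp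
    then show ?thesis
      using that c_prefix[of n "Suc k"] c_prefix[of "Suc k" n] unfolding \<mu>_def
      by (metis nle_le nth_append)
  qed
  have init: "initial_string \<mu> j = take j (c n)" if "j \<le> length (c n)" for j n
    using that by (intro nth_equalityI) (auto simp: initial_string_def \<mu>)
  have "enumeration \<mu> A"
    unfolding enumeration_def
  proof
    show "range \<mu> \<subseteq> A"
    proof clarify
      fix k
      have "k < length (c (Suc k))" using c_len[of "Suc k"] by simp
      then show "\<mu> k \<in> A" using c_sub[of "Suc k"] unfolding \<mu>_def by auto
    qed
    show "A \<subseteq> range \<mu>"
    proof
      fix a assume "a \<in> A"
      then obtain n where "a = w n" using w by auto
      then have "a \<in> set (c (Suc n))" by (simp add: c_Suc)
      then show "a \<in> range \<mu>" by (metis \<mu> in_set_conv_nth rangeI)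
    qed
  qed
  then obtain i N where N: "\<And>s. s \<ge> N \<Longrightarrow> M (initial_string \<mu> s) = i"
    using conv unfolding eventually_sequentially by meson
  have "initial_string \<mu> (length (c N)) = c N" using init[of "length (c N)" N] by simp
  \<comment> \<open>\<open>c N @ t (c N)\<close> is a prefix of \<open>c (Suc N)\<close>. Thus both
    sides of the change lie beyond \<open>N\<close>, where \<open>M\<close> should be
    constant.\<close>
  moreover have "initial_string \<mu> (length (c N @ t (c N))) = c N @ t (c N)"
    using init[of "length (c N @ t (c N))" "Suc N"] by (simp add: c_Suc)
  ultimately have "M (c N) = i" "M (c N @ t (c N)) = i"
    using N[of "length (c N)"] N[of "length (c N @ t (c N))"] c_len[of N] by simp_all
  then show False using t[OF c_sub[of N]] by simp
qed

lemma universal_imp_locking: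
  assumes "equiv UNIV E" and "universal \<phi> E"
  shows "locking_property \<phi> E"
proof -
  have sym: "sym E" and trans: "trans E"
    using assms(1) by (simp_all add: equiv_def)
  have "learnable \<phi> E {A. ce \<phi> A \<and> A \<noteq> {}}"
    using assms(2) unfolding universal_def by simp
  then obtain M where "\<forall>e. W \<phi> e \<in> {A. ce \<phi> A \<and> A \<noteq> {}} \<longrightarrow> (\<forall>\<mu>. enumeration \<mu> (W \<phi> e) \<longrightarrow>
      (\<exists>i. (i, e) \<in> E \<and> (\<forall>\<^sub>F s in sequentially. M (initial_string \<mu> s) = i)))"
    unfolding learnable_def by (rule exE)
  moreover have "ce \<phi> (W \<phi> e)" for e
    by (auto simp: ce_def)
  ultimately have M: "\<And>e \<mu>. W \<phi> e \<noteq> {} \<Longrightarrow> enumeration \<mu> (W \<phi> e) \<Longrightarrow>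
      \<exists>i. (i, e) \<in> E \<and> (\<forall>\<^sub>F s in sequentially. M (initial_string \<mu> s) = i)"
    by simp
  have "\<exists>k. \<forall>i\<ge>k. (b i, e) \<in> E"
    if ne: "W \<phi> e \<noteq> {}" and mono: "\<And>i. W \<phi> (b i) \<subseteq> W \<phi> (b (Suc i))"
      and un: "(\<Union>i. W \<phi> (b i)) = W \<phi> e" for e and b :: "nat \<Rightarrow> nat"
  proof -
    have "\<exists>\<sigma>. set \<sigma> \<subseteq> W \<phi> e \<and> (\<forall>\<tau>. set \<tau> \<subseteq> W \<phi> e \<longrightarrow> M (\<sigma> @ \<tau>) = M \<sigma>)"
      using M[OF ne] by (intro locking_string_exists[OF ne]) blast
    then obtain \<sigma> where \<sigma>: "set \<sigma> \<subseteq> W \<phi> e"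
        "\<And>\<tau>. set \<tau> \<subseteq> W \<phi> e \<Longrightarrow> M (\<sigma> @ \<tau>) = M \<sigma>"
      by auto
    \<comment> \<open>Enumerate \<open>W \<phi> d\<close> starting with \<open>\<sigma>\<close>.
      Success on \<open>d\<close> makes the limit equivalent to \<open>d\<close>, while locking
      inside the larger set \<open>W \<phi> e\<close> keeps it equal to
      \<open>M \<sigma>\<close>.\<close>
    have sound: "(M \<sigma>, d) \<in> E" if d: "set \<sigma> \<subseteq> W \<phi> d" "W \<phi> d \<subseteq> W \<phi> e" "W \<phi> d \<noteq> {}" for d
    proof -
      obtain w :: "nat \<Rightarrow> nat" where w: "range w = W \<phi> d"
        using range_from_nat_into[OF d(3)] by auto
      define \<mu> where "\<mu> k = (if k < length \<sigma> then \<sigma> ! k else w (k - length \<sigma>))" for k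
      have range: "range \<mu> = W \<phi> d"
      proof
        show "range \<mu> \<subseteq> W \<phi> d" using w d(1) by (auto simp: \<mu>_def)
        show "W \<phi> d \<subseteq> range \<mu>"
        proof
          fix a assume "a \<in> W \<phi> d"
          then obtain n where "a = w n" using w by auto
          then have "a = \<mu> (length \<sigma> + n)" by (simp add: \<mu>_def)
          then show "a \<in> range \<mu>" by blast
        qed
      qed
      then obtain i N where i: "(i, d) \<in> E" and
          N: "\<And>s. s \<ge> N \<Longrightarrow> M (initial_string \<mu> s) = i"
        using M[OF d(3), of \<mu>] unfolding enumeration_def eventually_sequentially by meson
      have "initial_string \<mu> (length \<sigma> + N) = \<sigma> @ map \<mu> [length \<sigma>..<length \<sigma> + N]"
        by (rule initial_string_append) (simp add: \<mu>_def)
      moreover have "set (map \<mu> [length \<sigma>..<length \<sigma> + N]) \<subseteq> W \<phi> e"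
        using range d(2) by auto
      ultimately have "M \<sigma> = i" using \<sigma>(2) N[of "length \<sigma> + N"] by simp
      with i show ?thesis by simp
    qed
    \<comment> \<open>\<open>\<sigma>\<close> may be empty; also covering \<open>a\<close> ensures
      that the sets \<open>W \<phi> (b i)\<close> are nonempty from \<open>k\<close> on, as
      \<open>sound\<close> requires.\<close>
    obtain a where a: "a \<in> W \<phi> e" using ne by blast
    have inc: "incseq (\<lambda>i. W \<phi> (b i))" using mono by (rule incseq_SucI)
    have "\<exists>k. F \<subseteq> W \<phi> (b k)" if "finite F" "F \<subseteq> W \<phi> e" for F
      using that
    proof (induction F rule: finite_induct)
      case (insert x F)
      then obtain k where "F \<subseteq> W \<phi> (b k)" by auto
      moreover obtain l where "x \<in> W \<phi> (b l)"
        using insert.prems un by (metis UN_E insert_subset)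
      ultimately have "insert x F \<subseteq> W \<phi> (b (max k l))"
        using incseqD[OF inc, of k "max k l"] incseqD[OF inc, of l "max k l"] by auto
      then show ?case by blast
    qed simp
    from this[of "insert a (set \<sigma>)"] obtain k where k: "insert a (set \<sigma>) \<subseteq> W \<phi> (b k)"
      using a \<sigma>(1) by auto
    have "(b i, e) \<in> E" if "i \<ge> k" for i
    proof -
      have "(M \<sigma>, b i) \<in> E"
        using k incseqD[OF inc that] un by (intro sound) auto
      moreover have "(M \<sigma>, e) \<in> E" using \<sigma>(1) ne by (intro sound) auto
      ultimately show ?thesis using symD[OF sym] transD[OF trans] by blast
    qed
    then show ?thesis by blast
  qed
  then show ?thesis unfolding locking_property_def by simp
qed

section \<open>A learner from the locking property\<close>

text \<open>If every finite \<open>F\<close> failed, the counterexamples could be chained into an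
  increasing sequence with union \<open>W \<phi> e\<close> and no term equivalent to
  \<open>e\<close>, against the locking property.\<close>

lemma locking_set_exists:
  assumes lock: "locking_property \<phi> E" and ne: "W \<phi> e \<noteq> {}"
  shows "\<exists>F. finite F \<and> F \<subseteq> W \<phi> e \<and>
    (\<forall>b. finite (W \<phi> b) \<and> F \<subseteq> W \<phi> b \<and> W \<phi> b \<subseteq> W \<phi> e \<longrightarrow> (b, e) \<in> E)"
proof (rule ccontr)
  assume "\<not> ?thesis"
  then have "\<forall>F. finite F \<and> F \<subseteq> W \<phi> e \<longrightarrow>
      (\<exists>b. finite (W \<phi> b) \<and> F \<subseteq> W \<phi> b \<and> W \<phi> b \<subseteq> W \<phi> e \<and> (b, e) \<notin> E)" by simp
  then obtain g where g: "\<And>F. finite F \<Longrightarrow> F \<subseteq> W \<phi> e \<Longrightarrow>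
      finite (W \<phi> (g F)) \<and> F \<subseteq> W \<phi> (g F) \<and> W \<phi> (g F) \<subseteq> W \<phi> e \<and> (g F, e) \<notin> E" by metis
  obtain w :: "nat \<Rightarrow> nat" where w: "range w = W \<phi> e"
    using range_from_nat_into[OF ne] by auto
  \<comment> \<open>Passing the previous set to \<open>g\<close> makes the sequence increasing;
    inserting \<open>w n\<close> makes it exhaust \<open>W \<phi> e\<close>.\<close>
  define b where "b = rec_nat (g {}) (\<lambda>n c. g (insert (w n) (W \<phi> c)))"
  have b_0: "b 0 = g {}" and b_Suc: "\<And>n. b (Suc n) = g (insert (w n) (W \<phi> (b n)))"
    by (auto simp: b_def)
  have inv: "finite (W \<phi> (b n)) \<and> W \<phi> (b n) \<subseteq> W \<phi> e \<and> (b n, e) \<notin> E" for n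
  proof (induction n)
    case 0
    show ?case using g[of "{}"] by (simp add: b_0)
  next
    case (Suc n)
    then show ?case using g[of "insert (w n) (W \<phi> (b n))"] w by (auto simp: b_Suc)
  qed
  have step: "insert (w n) (W \<phi> (b n)) \<subseteq> W \<phi> (b (Suc n))" for n
    using g[of "insert (w n) (W \<phi> (b n))"] inv[of n] w by (auto simp: b_Suc)
  have "w n \<in> (\<Union>i. W \<phi> (b i))" for n using step[of n] by auto
  then have "W \<phi> e \<subseteq> (\<Union>i. W \<phi> (b i))"
    unfolding w[symmetric] by (rule image_subsetI)
  then have "(\<Union>i. W \<phi> (b i)) = W \<phi> e"
    using inv by (intro subset_antisym UN_least) simp_all
  then have "\<exists>k. \<forall>i\<ge>k. (b i, e) \<in> E"
    using lock[unfolded locking_property_def, rule_format, of e b] ne inv step by simp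
  then show False using inv by blast
qed

lemma locking_imp_universal:
  assumes acc: "acceptable_numbering \<phi>" and E: "equiv UNIV E" and lock: "locking_property \<phi> E"
  shows "universal \<phi> E"
proof -
  obtain idx where idx: "\<And>S. finite S \<Longrightarrow> W \<phi> (idx S) = S"
    using finite_imp_ce[OF acc] unfolding ce_def by metis
  \<comment> \<open>Indices of the growing finite sets may change forever, but a learner must settle
    on one number. A fixed representative per class turns eventual equivalence into eventual
    equality.\<close>
  define rep where "rep i = (SOME j. j \<in> E `` {i})" for i
  have rep: "(rep i, i) \<in> E" for i
  proof -
    have "i \<in> E `` {i}" by (rule equiv_class_self[OF E UNIV_I])
    then have "(i, rep i) \<in> E" unfolding rep_def by (metis someI Image_singleton_iff)
    then show ?thesis using E by (simp add: equiv_def symD)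
  qed
  have rep_eq: "rep i = rep j" if "(i, j) \<in> E" for i j
    using equiv_class_eq[OF E that] by (simp add: rep_def)
  define M where "M \<sigma> = rep (idx (set \<sigma>))" for \<sigma>
  have conv: "\<forall>\<^sub>F s in sequentially. M (initial_string \<mu> s) = rep e"
    if ne: "W \<phi> e \<noteq> {}" and en: "enumeration \<mu> (W \<phi> e)" for e \<mu>
  proof -
    obtain F where F: "finite F" "F \<subseteq> W \<phi> e"
        "\<And>b. finite (W \<phi> b) \<Longrightarrow> F \<subseteq> W \<phi> b \<Longrightarrow> W \<phi> b \<subseteq> W \<phi> e \<Longrightarrow> (b, e) \<in> E"
      using locking_set_exists[OF lock ne] by metis
    have range: "range \<mu> = W \<phi> e" using en by (simp add: enumeration_def)
    then obtain I where I: "finite I" "F = \<mu> ` I"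
      using finite_subset_image[OF F(1), of \<mu> UNIV] F(2) by auto
    \<comment> \<open>By stage \<open>n\<close> all of \<open>F\<close> has been seen, so from then
      on the content lies between \<open>F\<close> and \<open>W \<phi> e\<close>.\<close>
    then obtain n where n: "I \<subseteq> {..<n}" using finite_nat_iff_bounded by blast
    have "M (initial_string \<mu> s) = rep e" if "s \<ge> n" for s
    proof -
      have "set (initial_string \<mu> s) = \<mu> ` {..<s}"
        by (simp add: initial_string_def atLeast0LessThan)
      moreover have "F \<subseteq> \<mu> ` {..<s}" using I n that by fastforce
      ultimately have "(idx (set (initial_string \<mu> s)), e) \<in> E"
        using range by (intro F(3)) (auto simp: idx)
      then show ?thesis by (simp add: M_def rep_eq)
    qed
    then show ?thesis by (auto simp: eventually_sequentially)
  qed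
  have "learnable \<phi> E K" if K: "\<forall>A\<in>K. ce \<phi> A \<and> A \<noteq> {}" for K
    unfolding learnable_def
  proof (intro exI[of _ M] allI impI)
    fix e \<mu>
    assume "W \<phi> e \<in> K" and "enumeration \<mu> (W \<phi> e)"
    with K conv have "\<forall>\<^sub>F s in sequentially. M (initial_string \<mu> s) = rep e"
      by simp
    with rep show "\<exists>i. (i, e) \<in> E \<and> (\<forall>\<^sub>F s in sequentially. M (initial_string \<mu> s) = i)"
      by blast
  qed
  then show ?thesis unfolding universal_def by simp
qed

theorem theorem3p10:
  fixes \<phi> :: "nat \<Rightarrow> nat \<rightharpoonup> nat" and E :: "nat rel"
  assumes "acceptable_numbering \<phi>"
    and "equiv UNIV E"
    and "ce_eq \<phi> \<subseteq> E"
  shows "universal \<phi> E \<longleftrightarrow> locking_property \<phi> E"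
  using universal_imp_locking locking_imp_universal assms by blast

end
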